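(* For all integers $n\ge 3$ and $K\ge 1$, the alternate $C_n$ snake with $K$ cycles is a difference graph.
   Context: A graph $G=(V,E)$ is a difference graph if there is a bijection $f$ from $V$ onto a set $S$ of positive integers such that for all distinct $x,y\in V$: $xy\in E$ if and only if $|f(x)-f(y)|\in S$. The alternate $C_n$ snake with $K$ cycles is obtained from a path by replacing every alternate edge by a cycle $C_n$, beginning with an unreplaced edge and ending with a cycle. Explicitly: vertices $u_0,u_1,\dots,u_{Kn}$, with edges $u_iu_{i+1}$ for $0\le i<Kn$ and $u_{kn+1}u_{(k+1)n}$ for $0\le k\le K-1$ (so the $k$-th cycle is $u_{kn+1}u_{kn+2}\cdots u_{(k+1)n}$, and consecutive cycles are joined by the edge $u_{(k+1)n}u_{(k+1)n+1}$, with a pendant edge $u_0u_1$ at the start). *)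

theory Defs
  imports Main
begin

definition simple_graph :: "'a set \<Rightarrow> 'a set set \<Rightarrow> bool" where
  "simple_graph V E \<longleftrightarrow> finite V \<and> (\<forall>e\<in>E. e \<subseteq> V \<and> card e = 2)"

definition difference_graph :: "'a set \<Rightarrow> 'a set set \<Rightarrow> bool" where
  "difference_graph V E \<longleftrightarrow>
     simple_graph V E \<and>
     (\<exists>(S :: int set) (f :: 'a \<Rightarrow> int).
        (\<forall>s\<in>S. s > 0) \<and> bij_betw f V S \<and>
        (\<forall>x\<in>V. \<forall>y\<in>V. x \<noteq> y \<longrightarrow> ({x, y} \<in> E \<longleftrightarrow> \<bar>f x - f y\<bar> \<in> S)))"

(* The vertex u_i is represented by its index i.  The edges {i, i + 1} form the spine; the
   second family closes the k-th cycle u_{kn+1}, ..., u_{(k+1)n}.  The edges joining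
   consecutive cycles and the initial pendant edge are the spine edges with n dvd i. *)

definition alt_snake_verts :: "nat \<Rightarrow> nat \<Rightarrow> nat set" where
  "alt_snake_verts n K = {0..K * n}"

definition alt_snake_edges :: "nat \<Rightarrow> nat \<Rightarrow> nat set set" where
  "alt_snake_edges n K =
     {{i, i + 1} | i. i < K * n} \<union> {{k * n + 1, (k + 1) * n} | k. k < K}"

lemma simple_graph_alt_snake:
  assumes "n \<ge> 3"
  shows "simple_graph (alt_snake_verts n K) (alt_snake_edges n K)"
proof -
  have "k * n + 1 < (k + 1) * n \<and> (k + 1) * n \<le> K * n" if "k < K" for k
    using that assms mult_le_mono1[of "k + 1" K n] by simp
  then show ?thesis
    by (fastforce simp: simple_graph_def alt_snake_verts_def alt_snake_edges_def card_2_iff)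
qed

end

theory Submission
  imports Defs
begin

text \<open>Put \<open>c = 2 ^ (n - 1) + 2\<close> and label \<open>u\<^sub>i\<close>, with \<open>i = k n + j\<close> and \<open>j < n\<close>, by
  \<open>2 ^ j c ^ k\<close>.  Consecutive labels double, except that the step onto a multiple of \<open>n\<close> is
  \<open>c ^ (k + 1) = 2 ^ (n - 1) c ^ k + 2 c ^ k\<close>, whose three terms label \<open>u\<^bsub>(k+1)n\<^esub>\<close> and its two
  neighbours on the cycle.  Since \<open>n \<ge> 3\<close>, two steps always more than double the label, so
  whenever a label is the sum of two labels, the larger summand is its predecessor, and the
  smaller one is then determined by the step.\<close>

definition snake_label :: "nat \<Rightarrow> nat \<Rightarrow> int" where
  "snake_label n i = 2 ^ (i mod n) * (2 ^ (n - 1) + 2) ^ (i div n)"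

lemma snake_label_pos: "snake_label n i > 0"
  by (simp add: snake_label_def add_pos_pos)

lemma snake_label_Suc_double:
  assumes "\<not> n dvd Suc i"
  shows "snake_label n (Suc i) = 2 * snake_label n i"
proof -
  have "Suc i mod n = Suc (i mod n)" "Suc i div n = i div n"
    using assms by (auto simp: mod_Suc div_Suc dvd_eq_mod_eq_0)
  then show ?thesis by (simp add: snake_label_def)
qed

text \<open>The index \<open>Suc (Suc i) - n\<close> is the first vertex of the cycle whose last
  vertex is \<open>Suc i\<close>, so the two summands label the two cycle neighbours of
  \<open>Suc i\<close>.\<close>

lemma snake_label_Suc_closing:
  assumes "n \<ge> 2" and "n dvd Suc i"
  shows "snake_label n (Suc i) = snake_label n i + snake_label n (Suc (Suc i) - n)"
proof -
  obtain m where m: "Suc i = n * m" using assms(2) by blast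
  then obtain k where k: "m = Suc k" by (cases m) auto
  have i: "i = (n - 1) + k * n" using m k assms(1) by (simp add: algebra_simps)
  have j: "Suc (Suc i) - n = 1 + k * n" using i assms(1) by simp
  have label: "snake_label n (l + q * n) = 2 ^ l * (2 ^ (n - 1) + 2) ^ q" if "l < n" for l q
    using that by (simp add: snake_label_def)
  have l1: "snake_label n (Suc i) = (2 ^ (n - 1) + 2) ^ Suc k"
    using label[of 0 "Suc k"] assms(1) m k by (simp add: mult.commute)
  have l2: "snake_label n i = 2 ^ (n - 1) * (2 ^ (n - 1) + 2) ^ k"
    using label[of "n - 1" k] assms(1) unfolding i by linarith
  have l3: "snake_label n (Suc (Suc i) - n) = 2 * (2 ^ (n - 1) + 2) ^ k"
    using label[of 1 k] assms(1) unfolding j by simp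
  show ?thesis unfolding l1 l2 l3 by (simp add: algebra_simps)
qed

lemma strict_mono_snake_label:
  assumes "n \<ge> 2"
  shows "strict_mono (snake_label n)"
proof (rule strict_mono_Suc_iff[THEN iffD2], rule allI)
  fix i show "snake_label n i < snake_label n (Suc i)"
    using snake_label_Suc_double[of n i] snake_label_Suc_closing[OF assms, of i]
      snake_label_pos[of n i] snake_label_pos[of n "Suc (Suc i) - n"]
    by (cases "n dvd Suc i") auto
qed

text \<open>Of two consecutive indices at most one is a multiple of \<open>n\<close>, so at least
  one of the two steps doubles exactly, and the other strictly increases the label.\<close>

lemma snake_label_two_steps:
  assumes "n \<ge> 3"
  shows "2 * snake_label n i < snake_label n (Suc (Suc i))"
proof -
  have less: "snake_label n j < snake_label n (Suc j)" for j
    using strict_mono_snake_label[of n] assms by (simp add: strict_mono_Suc_iff)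
  have "\<not> (n dvd Suc i \<and> n dvd Suc (Suc i))"
    using assms dvd_diff_nat[of n "Suc (Suc i)" "Suc i"] by auto
  then show ?thesis
    using less[of i] less[of "Suc i"] snake_label_Suc_double[of n i]
      snake_label_Suc_double[of n "Suc i"] by linarith
qed

lemma snake_label_sumD:
  assumes "n \<ge> 3" and "x \<le> y" and sum: "snake_label n z = snake_label n x + snake_label n y"
  shows "z = Suc y" and "if n dvd z then x + n = Suc z else x = y"
proof -
  have mono: "strict_mono (snake_label n)"
    using strict_mono_snake_label[of n] assms(1) by simp
  note le = strict_mono_less_eq[OF mono] and less = strict_mono_less[OF mono]
    and eq = strict_mono_eq[OF mono]
  have "y < z" using sum snake_label_pos[of n x] less[of y z] by linarith
  \<comment> \<open>As \<open>x \<le> y\<close>, the sum is at most twice the label of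
    \<open>y\<close>, hence less than the label two steps later.\<close>
  moreover have "\<not> Suc (Suc y) \<le> z"
    using sum le[of x y] \<open>x \<le> y\<close> snake_label_two_steps[OF assms(1), of y]
      le[of "Suc (Suc y)" z] by linarith
  ultimately show z: "z = Suc y" by simp
  show "if n dvd z then x + n = Suc z else x = y"
  proof (cases "n dvd z")
    case True
    then have "snake_label n x = snake_label n (Suc (Suc y) - n)"
      using snake_label_Suc_closing[of n y] sum z assms(1) by simp
    \<comment> \<open>This makes the natural-number subtraction \<open>Suc (Suc y) - n\<close>
      exact.\<close>
    moreover have "n \<le> Suc y" using True z by (simp add: dvd_imp_le)
    ultimately show ?thesis using True z eq by simp
  next
    case False
    then show ?thesis using snake_label_Suc_double[of n y] sum z eq by simp
  qed
qed

text \<open>This removes the cycle number \<open>k\<close>, giving the edges the same arithmetic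
  form as the label differences. A closing edge has \<open>x = k * n + 1\<close> and
  \<open>y = (k + 1) * n\<close>; the bound on \<open>y\<close> forces \<open>k < K\<close>.\<close>

lemma alt_snake_edge_iff:
  assumes "n \<ge> 2" and "x < y" and "y \<le> K * n"
  shows "{x, y} \<in> alt_snake_edges n K \<longleftrightarrow> y = Suc x \<or> n dvd y \<and> x + n = Suc y"
proof -
  have "{x, y} = {i, i + 1} \<longleftrightarrow> x = i \<and> y = Suc i" for i
    using \<open>x < y\<close> by (auto simp: doubleton_eq_iff)
  moreover have "{x, y} = {k * n + 1, (k + 1) * n} \<longleftrightarrow> x = k * n + 1 \<and> y = (k + 1) * n" for k
    using assms(1,2) by (auto simp: doubleton_eq_iff)
  moreover have "(\<exists>k<K. x = k * n + 1 \<and> y = (k + 1) * n) \<longleftrightarrow> n dvd y \<and> x + n = Suc y"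
  proof
    assume *: "n dvd y \<and> x + n = Suc y"
    then obtain m where m: "y = n * m" by blast
    then obtain k where k: "m = Suc k" using \<open>x < y\<close> by (cases m) auto
    have "n * Suc k \<le> n * K" using assms(3) m k by (simp add: mult.commute)
    then have "k < K" using assms(1) by (simp del: mult_Suc_right)
    then show "\<exists>k<K. x = k * n + 1 \<and> y = (k + 1) * n"
      using * m k by (intro exI[of _ k]) (simp add: algebra_simps)
  qed auto
  ultimately show ?thesis
    using assms(2,3) by (auto simp: alt_snake_edges_def)
qed

lemma snake_label_diff_iff:
  assumes "n \<ge> 3" and "x < y" and "y \<le> N"
  shows "snake_label n y - snake_label n x \<in> snake_label n ` {0..N}
    \<longleftrightarrow> y = Suc x \<or> n dvd y \<and> x + n = Suc y"
proof
  assume "snake_label n y - snake_label n x \<in> snake_label n ` {0..N}"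
  then obtain z where "snake_label n y = snake_label n x + snake_label n z"
    by (auto simp: algebra_simps)
  then show "y = Suc x \<or> n dvd y \<and> x + n = Suc y"
    \<comment> \<open>Either \<open>x\<close> is the larger summand, hence the predecessor of
      \<open>y\<close>, or it is the smaller one, which the step onto \<open>y\<close>
      determines.\<close>
    using snake_label_sumD[OF assms(1), of x z y] snake_label_sumD[OF assms(1), of z x y]
    by (cases "x \<le> z") (auto split: if_splits)
next
  have mem: "snake_label n w \<in> snake_label n ` {0..N}" if "w < y" for w
    using that assms(3) by auto
  assume edge: "y = Suc x \<or> n dvd y \<and> x + n = Suc y"
  show "snake_label n y - snake_label n x \<in> snake_label n ` {0..N}"
  proof (cases "n dvd y")
    case True
    obtain w where w: "y = Suc w" using \<open>x < y\<close> by (cases y) auto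
    have "snake_label n y = snake_label n w + snake_label n (Suc y - n)"
      using snake_label_Suc_closing[of n w] True w assms(1) by simp
    \<comment> \<open>Since \<open>x\<close> carries one of the two summands, the difference is the
      other, whose index is also below \<open>y\<close>.\<close>
    moreover have "x = w \<or> x = Suc y - n" using edge w by auto
    moreover have "w < y" "Suc y - n < y" using w assms by auto
    ultimately show ?thesis using mem by auto
  next
    case False
    then show ?thesis using snake_label_Suc_double[of n x] edge mem[of x] by auto
  qed
qed

theorem theorem3p9:
  fixes n K :: nat
  assumes "n \<ge> 3" and "K \<ge> 1"
  shows "difference_graph (alt_snake_verts n K) (alt_snake_edges n K)"
proof -
  let ?V = "alt_snake_verts n K" and ?E = "alt_snake_edges n K"
  let ?f = "snake_label n"
  have mono: "strict_mono ?f"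
    using strict_mono_snake_label[of n] assms(1) by simp
  have edge: "{x, y} \<in> ?E \<longleftrightarrow> \<bar>?f x - ?f y\<bar> \<in> ?f ` ?V"
    if "x < y" "y \<in> ?V" for x y
    using alt_snake_edge_iff[of n x y K] snake_label_diff_iff[of n x y "K * n"]
      strict_mono_less[OF mono, of x y] that assms(1)
    by (simp add: alt_snake_verts_def abs_if)
  have "{x, y} \<in> ?E \<longleftrightarrow> \<bar>?f x - ?f y\<bar> \<in> ?f ` ?V"
    if "x \<in> ?V" "y \<in> ?V" "x \<noteq> y" for x y
  proof (cases "x < y")
    case True
    then show ?thesis using edge that by blast
  next
    case False
    then show ?thesis
      using edge[of y x] that by (simp add: insert_commute abs_minus_commute)
  qed
  moreover have "bij_betw ?f ?V (?f ` ?V)"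
    using strict_mono_eq[OF mono] by (auto simp: bij_betw_def inj_on_def)
  moreover have "\<forall>s \<in> ?f ` ?V. s > 0"
    by (auto simp: snake_label_pos)
  ultimately show ?thesis
    using simple_graph_alt_snake[OF assms(1)] unfolding difference_graph_def by blast
qed

end
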